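(* Let $C_1,C_2\subset\mathbb{R}^2$ be two simple closed curves, oriented counter-clockwise, whose intersections are all transverse, and let $p_1,\dots,p_{2N}$ ($N\ge 1$) be their intersection points. Let $\sim$ be the relation on $\{p_1,\dots,p_{2N}\}$ defined in the context. Then $\sim$ is symmetric: for all $i,j\in\{1,\dots,2N\}$, $p_i\sim p_j$ implies $p_j\sim p_i$.
   Context: Setting. $C_1,C_2\subset\mathbb{R}^2$ are simple (non-self-intersecting) closed piecewise $C^1$ curves, each oriented counter-clockwise, meeting in a finite (necessarily even) number $2N\ge 2$ of pairwise distinct points $p_1,\dots,p_{2N}$. Each $C_j$ is $C^1$ with nonzero tangent near every $p_i$, and the intersections are transverse: the unit tangent vectors $\mathbf{1}_1(p_i)$ and $\mathbf{1}_2(p_i)$ of $C_1$ and $C_2$ at $p_i$ (in the counter-clockwise direction) are linearly independent. Orientation. For each intersection point, $\rho(p_i)=\operatorname{sgn}(\sin\theta_i)\in\{-1,+1\}$, where $\theta_i$ is the oriented angle from $\mathbf{1}_1(p_i)$ to $\mathbf{1}_2(p_i)$. Adjacency. For $m\in\{1,2\}$, $C_m^{+}[p_i,p_j]$ (resp. $C_m^{-}[p_i,p_j]$) denotes the closed segment of $C_m$ traversed from $p_i$ to $p_j$ in the counter-clockwise (resp. clockwise) direction; when $i=j$ it is the whole curve, traversed once. Define $A^{\pm}_{C_m}(p_i,p_j)=1$ if no $p_k$ with $k\ne i$ and $k\neq j$ lies on $C_m^{\pm}[p_i,p_j]$, and $A^{\pm}_{C_m}(p_i,p_j)=0$ otherwise.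 Signed adjacency. $\gamma(p_i,p_j)=\frac{\rho(p_i)+1}{2}A^{+}_{C_1}(p_i,p_j)-\frac{\rho(p_i)-1}{2}A^{-}_{C_2}(p_i,p_j)$; that is, $\gamma(p_i,p_j)=A^+_{C_1}(p_i,p_j)$ if $\rho(p_i)=1$ and $\gamma(p_i,p_j)=A^-_{C_2}(p_i,p_j)$ if $\rho(p_i)=-1$. Relation. $p_i\sim p_j$ if and only if there exist an integer $K\ge 1$ and a sequence of intersection points $p_{\alpha_1},\dots,p_{\alpha_K}$ with $p_{\alpha_1}=p_i$, $p_{\alpha_K}=p_j$ and $\prod_{k=1}^{K-1}\gamma(p_{\alpha_k},p_{\alpha_{k+1}})=1$ (the empty product, for $K=1$, equals $1$). *)

theory Defs
  imports "HOL-Complex_Analysis.Complex_Analysis"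
begin

text \<open>
  The plane is identified with the complex numbers. A closed curve is given by a 1-periodic map on
  the whole real line, so that tangents and arcs need no special treatment at the base point
  \<open>c 0 = c 1\<close>; the library's path notions see its restriction to \<open>{0..1}\<close>.
  Counter-clockwise means winding number 1 around the enclosed points.
\<close>

definition ccw_simple_closed_curve :: "(real \<Rightarrow> complex) \<Rightarrow> bool" where
  "ccw_simple_closed_curve c \<longleftrightarrow>
     (\<forall>t. c (t + 1) = c t) \<and> simple_path c \<and> valid_path c \<and>
     (\<forall>z \<in> inside (path_image c). winding_number c z = 1)"

definition param :: "(real \<Rightarrow> complex) \<Rightarrow> complex \<Rightarrow> real" where
  "param c p = (THE t. 0 \<le> t \<and> t < 1 \<and> c t = p)"

definition regular_near :: "(real \<Rightarrow> complex) \<Rightarrow> complex \<Rightarrow> bool" where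
  "regular_near c p \<longleftrightarrow>
     (\<exists>e>0. c C1_differentiable_on {param c p - e <..< param c p + e} \<and>
        (\<forall>t \<in> {param c p - e <..< param c p + e}. vector_derivative c (at t) \<noteq> 0))"

text \<open>On vectors, \<^const>\<open>sgn\<close> is normalisation to length 1.\<close>

definition unit_tangent :: "(real \<Rightarrow> complex) \<Rightarrow> complex \<Rightarrow> complex" where
  "unit_tangent c p = sgn (vector_derivative c (at (param c p)))"

definition crossings :: "(real \<Rightarrow> complex) \<Rightarrow> (real \<Rightarrow> complex) \<Rightarrow> complex set" where
  "crossings c1 c2 = path_image c1 \<inter> path_image c2"

text \<open>The inequality is needed because \<open>{u, v}\<close> is a set: \<open>{u, u}\<close> is independent for \<open>u \<noteq> 0\<close>.\<close>

definition transverse_at :: "(real \<Rightarrow> complex) \<Rightarrow> (real \<Rightarrow> complex) \<Rightarrow> complex \<Rightarrow> bool" where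
  "transverse_at c1 c2 p \<longleftrightarrow>
     unit_tangent c1 p \<noteq> unit_tangent c2 p \<and> independent {unit_tangent c1 p, unit_tangent c2 p}"

text \<open>The oriented angle from \<open>u\<close> to \<open>v\<close> is \<open>Arg (v / u)\<close>.\<close>

definition rho :: "(real \<Rightarrow> complex) \<Rightarrow> (real \<Rightarrow> complex) \<Rightarrow> complex \<Rightarrow> real" where
  "rho c1 c2 p = sgn (sin (Arg (unit_tangent c2 p / unit_tangent c1 p)))"

text \<open>
  For \<open>p = q\<close> both parameter intervals below have length 1, so the arc is the whole curve.
\<close>

definition arc_ccw :: "(real \<Rightarrow> complex) \<Rightarrow> complex \<Rightarrow> complex \<Rightarrow> complex set" where
  "arc_ccw c p q =
     c ` {param c p .. (if param c p < param c q then param c q else param c q + 1)}"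

definition arc_cw :: "(real \<Rightarrow> complex) \<Rightarrow> complex \<Rightarrow> complex \<Rightarrow> complex set" where
  "arc_cw c p q =
     c ` {(if param c q < param c p then param c q else param c q - 1) .. param c p}"

definition adj_ccw :: "complex set \<Rightarrow> (real \<Rightarrow> complex) \<Rightarrow> complex \<Rightarrow> complex \<Rightarrow> real" where
  "adj_ccw P c p q = (if \<exists>r\<in>P. r \<noteq> p \<and> r \<noteq> q \<and> r \<in> arc_ccw c p q then 0 else 1)"

definition adj_cw :: "complex set \<Rightarrow> (real \<Rightarrow> complex) \<Rightarrow> complex \<Rightarrow> complex \<Rightarrow> real" where
  "adj_cw P c p q = (if \<exists>r\<in>P. r \<noteq> p \<and> r \<noteq> q \<and> r \<in> arc_cw c p q then 0 else 1)"

definition signed_adj ::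
    "(real \<Rightarrow> complex) \<Rightarrow> (real \<Rightarrow> complex) \<Rightarrow> complex \<Rightarrow> complex \<Rightarrow> real" where
  "signed_adj c1 c2 p q =
     (rho c1 c2 p + 1) / 2 * adj_ccw (crossings c1 c2) c1 p q
     - (rho c1 c2 p - 1) / 2 * adj_cw (crossings c1 c2) c2 p q"

definition linked ::
    "(real \<Rightarrow> complex) \<Rightarrow> (real \<Rightarrow> complex) \<Rightarrow> complex \<Rightarrow> complex \<Rightarrow> bool" where
  "linked c1 c2 p q \<longleftrightarrow>
     (\<exists>K\<ge>1. \<exists>a :: nat \<Rightarrow> complex.
        (\<forall>k\<in>{1..K}. a k \<in> crossings c1 c2) \<and> a 1 = p \<and> a K = q \<and>
        (\<Prod>k\<in>{1..<K}. signed_adj c1 c2 (a k) (a (k + 1))) = 1)"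

end

theory Submission
  imports Defs
begin

text \<open>
  When \<open>g\<close> crosses a counter-clockwise simple closed curve \<open>c\<close> transversely, the winding number of
  \<open>c\<close> around the point of \<open>g\<close> jumps by \<open>1\<close> if \<open>g\<close> passes from the right of \<open>c\<close> to its left, and by
  \<open>- 1\<close> otherwise. As its values are \<open>1\<close> inside and \<open>0\<close> outside, \<open>g\<close> enters the interior in the
  first case and leaves it in the second, so \<open>rho\<close> changes sign between successive crossings, along
  either curve. Hence any two \<open>gamma\<close>-predecessors of a point have the same \<open>rho\<close>, so both are its
  predecessors on \<open>C\<^sub>1\<close> or both its successors on \<open>C\<^sub>2\<close>, and therefore coincide. The signed adjacency is
  thus the graph of an injection of the finite set of crossings into itself, that is, of a
  permutation, and reachability along a permutation of a finite set is symmetric.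
\<close>

section \<open>Winding numbers of paths in convex sets\<close>

text \<open>
  Seen from \<open>z\<close>, a convex set that misses \<open>z\<close> subtends an angle less than \<open>pi\<close>, hence after division
  by a vector pointing into it the principal branch of the logarithm is a primitive.
\<close>

lemma winding_number_convex_Ln:
  assumes "valid_path g" "path_image g \<subseteq> K" "convex K" "z \<notin> K"
  shows "winding_number g z = Ln ((pathfinish g - z) / (pathstart g - z)) / (2 * pi * \<i>)"
proof -
  let ?a = "pathstart g"
  have "?a \<in> K"
    using assms(2) pathstart_in_path_image by blast
  then have nz: "?a - z \<noteq> 0"
    using assms(4) by auto
  have slit: "(w - z) / (?a - z) \<notin> \<real>\<^sub>\<le>\<^sub>0" if "w \<in> K" for w
  proof
    assume "(w - z) / (?a - z) \<in> \<real>\<^sub>\<le>\<^sub>0"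
    then obtain r where r: "(w - z) / (?a - z) = of_real r" "r \<le> 0"
      by (auto elim: nonpos_Reals_cases)
    then have "w - z = of_real r * (?a - z)"
      using nz by (simp add: field_simps)
    then have "(1 - of_real r) * z = w - of_real r * ?a"
      by (simp add: algebra_simps)
    moreover have "(1 - of_real r :: complex) \<noteq> 0"
      using r(2) by (metis diff_eq_diff_eq diff_self of_real_1 of_real_eq_iff not_one_le_zero)
    ultimately have "z = (w - of_real r * ?a) / (1 - of_real r)"
      by (simp add: field_simps)
    \<comment> \<open>The weights are nonnegative because \<open>r\<close> is nonpositive, and they
      sum to 1: \<open>z\<close> would lie on the segment between \<open>w\<close> and the start
      point, hence in \<open>K\<close>.\<close>
    also have "\<dots> = (1 / (1 - r)) *\<^sub>R w + (- r / (1 - r)) *\<^sub>R ?a"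
      by (simp add: scaleR_conv_of_real diff_divide_distrib)
    also have "\<dots> \<in> K"
      using r(2) by (intro convexD[OF assms(3) that \<open>?a \<in> K\<close>]) (auto simp: field_simps)
    finally show False
      using assms(4) by simp
  qed
  have "((\<lambda>w. Ln ((w - z) / (?a - z))) has_field_derivative 1 / (w - z)) (at w within K)"
    if "w \<in> K" for w
  proof -
    have "((\<lambda>w. (w - z) / (?a - z)) has_field_derivative 1 / (?a - z)) (at w within K)"
      by (intro derivative_eq_intros) (use nz in auto)
    from DERIV_chain2[OF has_field_derivative_Ln[OF slit[OF that]] this]
    show ?thesis using nz by simp
  qed
  from contour_integral_primitive[OF this assms(1,2)]
  have "contour_integral g (\<lambda>w. 1 / (w - z)) = Ln ((pathfinish g - z) / (?a - z))"
    using nz by (simp add: contour_integral_unique)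
  moreover have "z \<notin> path_image g"
    using assms by blast
  ultimately show ?thesis
    using assms(1) by (simp add: winding_number_valid_path)
qed

text \<open>The imaginary part of \<open>Ln\<close> is \<open>Arg\<close>, and division by
  \<open>2 * pi * \<i>\<close> turns it into the real part.\<close>

lemma Re_winding_number_convex:
  assumes "valid_path g" "path_image g \<subseteq> K" "convex K" "z \<notin> K"
  shows "Re (winding_number g z) = Arg ((pathfinish g - z) / (pathstart g - z)) / (2 * pi)"
proof -
  have "pathfinish g - z \<noteq> 0" "pathstart g - z \<noteq> 0"
    using assms pathstart_in_path_image pathfinish_in_path_image by fastforce+
  then show ?thesis
    by (simp add: winding_number_convex_Ln[OF assms] Arg_def Re_divide power2_eq_square)
qed

section \<open>Directions and angles of a differentiable curve near a point\<close>

text \<open>The derivative is defined by a remainder scaled by the inverse of the absolute value of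
  \<open>x - s\<close>. Dividing by \<open>x - s\<close> itself changes at most the sign, so the
  norms agree.\<close>

lemma difference_quotient_tendsto:
  fixes g :: "real \<Rightarrow> complex"
  assumes "(g has_vector_derivative d) (at s)"
  shows "((\<lambda>x. (g x - g s) / of_real (x - s)) \<longlongrightarrow> d) (at s)"
proof -
  have "((\<lambda>x. (g x - g s - (x - s) *\<^sub>R d) /\<^sub>R \<bar>x - s\<bar>) \<longlongrightarrow> 0) (at s)"
    using assms by (simp add: has_vector_derivative_def has_derivative_at_within)
  then have "((\<lambda>x. norm ((g x - g s - (x - s) *\<^sub>R d) /\<^sub>R \<bar>x - s\<bar>)) \<longlongrightarrow> 0) (at s)"
    by (rule tendsto_norm_zero)
  then have "((\<lambda>x. norm ((g x - g s) / of_real (x - s) - d)) \<longlongrightarrow> 0) (at s)"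
  proof (rule tendsto_cong[THEN iffD1, rotated])
    show "\<forall>\<^sub>F x in at s. norm ((g x - g s - (x - s) *\<^sub>R d) /\<^sub>R \<bar>x - s\<bar>) =
            norm ((g x - g s) / of_real (x - s) - d)"
      unfolding eventually_at_filter
    proof (intro always_eventually allI impI)
      fix x assume "x \<noteq> s"
      then have "(g x - g s) / of_real (x - s) - d = (g x - g s - (x - s) *\<^sub>R d) / of_real (x - s)"
        by (simp add: field_simps scaleR_conv_of_real)
      then show "norm ((g x - g s - (x - s) *\<^sub>R d) /\<^sub>R \<bar>x - s\<bar>) = norm ((g x - g s) / of_real (x - s) - d)"
        by (simp only: norm_scaleR norm_mult norm_inverse norm_of_real abs_inverse abs_abs divide_inverse_commute)
    qed
  qed
  then show ?thesis
    using tendsto_norm_zero_iff LIM_zero_iff by blast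
qed

text \<open>The condition bounds the absolute value of one real-affine function of \<open>w\<close>
  by another, so the triangle inequality suffices. For positive \<open>e\<close> the set is the cone
  with apex \<open>p\<close> around the direction \<open>u\<close>; convexity makes it usable as
  \<open>K\<close> in \<open>Re_winding_number_convex\<close>.\<close>

lemma convex_sector:
  fixes p u :: complex
  shows "convex {w. \<bar>Im ((w - p) / u)\<bar> \<le> e * Re ((w - p) / u)}"
proof (rule convexI, unfold mem_Collect_eq)
  fix x y :: complex and a b :: real
  assume x: "\<bar>Im ((x - p) / u)\<bar> \<le> e * Re ((x - p) / u)"
    and y: "\<bar>Im ((y - p) / u)\<bar> \<le> e * Re ((y - p) / u)"
    and ab: "0 \<le> a" "0 \<le> b" "a + b = 1"
  have "a *\<^sub>R x + b *\<^sub>R y - p = a *\<^sub>R (x - p) + b *\<^sub>R (y - p)"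
  proof -
    have "p = a *\<^sub>R p + b *\<^sub>R p"
      by (metis ab(3) scaleR_left_distrib scaleR_one)
    then have "a *\<^sub>R x + b *\<^sub>R y - p = a *\<^sub>R x + b *\<^sub>R y - (a *\<^sub>R p + b *\<^sub>R p)" by simp
    then show ?thesis by (simp only: algebra_simps)
  qed
  then have eq: "(a *\<^sub>R x + b *\<^sub>R y - p) / u = a *\<^sub>R ((x - p) / u) + b *\<^sub>R ((y - p) / u)"
    by (simp add: add_divide_distrib scaleR_conv_of_real)
  have "\<bar>Im ((a *\<^sub>R x + b *\<^sub>R y - p) / u)\<bar> \<le> a * \<bar>Im ((x - p) / u)\<bar> + b * \<bar>Im ((y - p) / u)\<bar>"
    unfolding eq using ab abs_triangle_ineq[of "a * Im ((x - p) / u)" "b * Im ((y - p) / u)"]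
    by (simp add: abs_mult)
  also have "\<dots> \<le> a * (e * Re ((x - p) / u)) + b * (e * Re ((y - p) / u))"
    using x y ab by (intro add_mono mult_left_mono)
  also have "\<dots> = e * Re ((a *\<^sub>R x + b *\<^sub>R y - p) / u)"
    unfolding eq by (simp add: algebra_simps)
  finally show "\<bar>Im ((a *\<^sub>R x + b *\<^sub>R y - p) / u)\<bar> \<le> e * Re ((a *\<^sub>R x + b *\<^sub>R y - p) / u)" .
qed

lemma Arg_uminus_of_Im_pos:
  assumes "Im z > 0"
  shows "Arg (- z) = Arg z - pi"
  using assms Arg_pos_iff[of z] by (subst Arg_minus) auto

text \<open>After division by \<open>u\<close>, the vector \<open>w\<close> is within slope
  \<open>e\<close> of the positive real axis, while \<open>d\<close> lies above both lines of slope
  \<open>e\<close> and \<open>- e\<close>. The turn from \<open>w\<close> to \<open>d\<close> is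
  therefore counter-clockwise and less than pi.\<close>

lemma Im_pos_divide_sector:
  assumes w: "\<bar>Im (w / u)\<bar> \<le> e * Re (w / u)" "w \<noteq> 0"
    and d: "e * \<bar>Re (d / u)\<bar> < Im (d / u)" and e: "e > 0"
  shows "Im (d / w) > 0"
proof -
  have u: "u \<noteq> 0" using d by auto
  define x where "x = w / u"
  define k where "k = d / u"
  have eq: "d / w = k / x" using u by (simp add: x_def k_def)
  have x: "\<bar>Im x\<bar> \<le> e * Re x" "x \<noteq> 0" using w u by (auto simp: x_def)
  have "Re x > 0"
    using x e by (smt (verit) complex_eq_iff mult_less_0_iff mult_eq_0_iff zero_complex.simps)
  have "\<bar>Re k * Im x\<bar> \<le> \<bar>Re k\<bar> * (e * Re x)"
    unfolding abs_mult using x by (intro mult_left_mono) auto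
  also have "\<dots> = (e * \<bar>Re k\<bar>) * Re x" by simp
  also have "\<dots> < Im k * Re x"
    using d \<open>Re x > 0\<close> by (intro mult_strict_right_mono) (auto simp: k_def)
  finally have "Im k * Re x - Re k * Im x > 0" by linarith
  moreover have "(Re x)\<^sup>2 + (Im x)\<^sup>2 > 0"
    using x(2) by (metis complex_neq_0)
  ultimately show ?thesis
    unfolding eq Im_divide by simp
qed

text \<open>The difference quotient divided by \<open>u\<close> tends to 1, which is interior to the
  cone around the positive real axis. Multiplying back by \<open>x - s\<close> gives the forward
  half cone after \<open>s\<close> and the backward one before \<open>s\<close>; the factor
  \<open>sgn (x - s)\<close> covers both.\<close>

lemma eventually_in_sector:
  fixes g :: "real \<Rightarrow> complex"
  assumes "(g has_vector_derivative u) (at s)" "u \<noteq> 0" "e > 0"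
  shows "\<forall>\<^sub>F x in at s. g x \<noteq> g s \<and> \<bar>Im ((g x - g s) / u)\<bar> \<le> e * (sgn (x - s) * Re ((g x - g s) / u))"
proof -
  have "((\<lambda>x. (g x - g s) / of_real (x - s) / u) \<longlongrightarrow> u / u) (at s)"
    by (intro tendsto_divide difference_quotient_tendsto assms tendsto_const)
  then have lim: "((\<lambda>x. (g x - g s) / of_real (x - s) / u) \<longlongrightarrow> 1) (at s)"
    using assms(2) by simp
  have "((\<lambda>x. e * Re ((g x - g s) / of_real (x - s) / u) - \<bar>Im ((g x - g s) / of_real (x - s) / u)\<bar>)
      \<longlongrightarrow> e * Re 1 - \<bar>Im 1\<bar>) (at s)"
    by (intro tendsto_intros lim)
  then have "\<forall>\<^sub>F x in at s. 0 < e * Re ((g x - g s) / of_real (x - s) / u)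
      - \<bar>Im ((g x - g s) / of_real (x - s) / u)\<bar>"
    by (rule order_tendstoD) (use assms in simp)
  moreover have "\<forall>\<^sub>F x in at s. x \<noteq> s"
    by (simp add: eventually_neq_at_within)
  ultimately show ?thesis
  proof eventually_elim
    case (elim x)
    define q where "q = (g x - g s) / of_real (x - s) / u"
    have q: "\<bar>Im q\<bar> < e * Re q"
      using elim by (simp add: q_def)
    have eq: "(g x - g s) / u = of_real (x - s) * q"
      using elim(2) by (simp add: q_def del: of_real_diff)
    have "\<bar>Im ((g x - g s) / u)\<bar> = \<bar>x - s\<bar> * \<bar>Im q\<bar>"
      unfolding eq by (simp add: abs_mult)
    also have "\<dots> \<le> \<bar>x - s\<bar> * (e * Re q)"
      using q by (intro mult_left_mono) auto
    also have "\<dots> = e * (sgn (x - s) * Re ((g x - g s) / u))"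
      unfolding eq by (simp add: abs_sgn)
    finally have "\<bar>Im ((g x - g s) / u)\<bar> \<le> e * (sgn (x - s) * Re ((g x - g s) / u))" .
    moreover have "g x \<noteq> g s"
      using q by (auto simp: q_def)
    ultimately show "g x \<noteq> g s \<and> \<bar>Im ((g x - g s) / u)\<bar> \<le> e * (sgn (x - s) * Re ((g x - g s) / u))"
      by simp
  qed
qed

text \<open>The limit \<open>d / u\<close> lies strictly outside the double cone, and the double
  cone is invariant under the real factor \<open>x - s\<close>.\<close>

lemma eventually_not_in_sector:
  fixes g :: "real \<Rightarrow> complex"
  assumes "(g has_vector_derivative d) (at s)" "e * \<bar>Re (d / u)\<bar> < Im (d / u)"
  shows "\<forall>\<^sub>F x in at s. e * \<bar>Re ((g x - g s) / u)\<bar> < \<bar>Im ((g x - g s) / u)\<bar>"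
proof -
  have u: "u \<noteq> 0" using assms(2) by auto
  have lim: "((\<lambda>x. (g x - g s) / of_real (x - s) / u) \<longlongrightarrow> d / u) (at s)"
    by (intro tendsto_divide difference_quotient_tendsto assms(1) tendsto_const u)
  have "((\<lambda>x. Im ((g x - g s) / of_real (x - s) / u) - e * \<bar>Re ((g x - g s) / of_real (x - s) / u)\<bar>)
      \<longlongrightarrow> Im (d / u) - e * \<bar>Re (d / u)\<bar>) (at s)"
    by (intro tendsto_intros lim)
  then have "\<forall>\<^sub>F x in at s. 0 < Im ((g x - g s) / of_real (x - s) / u)
      - e * \<bar>Re ((g x - g s) / of_real (x - s) / u)\<bar>"
    by (rule order_tendstoD) (use assms in simp)
  moreover have "\<forall>\<^sub>F x in at s. x \<noteq> s"
    by (simp add: eventually_neq_at_within)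
  ultimately show ?thesis
  proof eventually_elim
    case (elim x)
    define q where "q = (g x - g s) / of_real (x - s) / u"
    have q: "e * \<bar>Re q\<bar> < \<bar>Im q\<bar>"
      using elim by (simp add: q_def)
    have eq: "(g x - g s) / u = of_real (x - s) * q"
      using elim(2) by (simp add: q_def del: of_real_diff)
    have "\<bar>x - s\<bar> * (e * \<bar>Re q\<bar>) < \<bar>x - s\<bar> * \<bar>Im q\<bar>"
      using q elim(2) by (intro mult_strict_left_mono) auto
    then show "e * \<bar>Re ((g x - g s) / u)\<bar> < \<bar>Im ((g x - g s) / u)\<bar>"
      unfolding eq by (simp add: abs_mult mult.left_commute)
  qed
qed

text \<open>Near \<open>s\<close>, \<open>g s - g x\<close> is close to
  \<open>- (x - s) * d\<close>, so its direction flips as \<open>x\<close> passes \<open>s\<close>,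
  whereas \<open>a - g x\<close> tends to \<open>a - g s\<close>. \<open>Arg\<close> ignores
  positive real factors, and a nonzero imaginary part keeps the limits off its cut.\<close>

lemma tendsto_Arg_quotient:
  fixes g :: "real \<Rightarrow> complex"
  assumes g: "(g has_vector_derivative d) (at s)" and a: "a \<noteq> g s" and im: "Im (d / (a - g s)) \<noteq> 0"
  shows "((\<lambda>x. Arg ((g s - g x) / (a - g x))) \<longlongrightarrow> Arg (- (d / (a - g s)))) (at_right s)"
    and "((\<lambda>x. Arg ((g s - g x) / (a - g x))) \<longlongrightarrow> Arg (d / (a - g s))) (at_left s)"
    and "((\<lambda>x. Arg ((a - g x) / (g s - g x))) \<longlongrightarrow> - Arg (- (d / (a - g s)))) (at_right s)"
    and "((\<lambda>x. Arg ((a - g x) / (g s - g x))) \<longlongrightarrow> - Arg (d / (a - g s))) (at_left s)"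
proof -
  define Q where "Q = (\<lambda>x. (g x - g s) / of_real (x - s) / (a - g x))"
  have cont: "(g \<longlongrightarrow> g s) (at s)"
    using g has_vector_derivative_continuous continuous_at isCont_def by blast
  have Q: "(Q \<longlongrightarrow> d / (a - g s)) (at s)"
    unfolding Q_def using a by (intro tendsto_intros difference_quotient_tendsto g cont) auto
  have im': "d / (a - g s) \<notin> \<real>\<^sub>\<le>\<^sub>0" "- (d / (a - g s)) \<notin> \<real>\<^sub>\<le>\<^sub>0"
    using im by (auto simp: complex_nonpos_Reals_iff)
  have R: "((\<lambda>x. Arg (- Q x)) \<longlongrightarrow> Arg (- (d / (a - g s)))) (at_right s)"
    using im' by (intro tendsto_intros tendsto_within_subset[OF Q]) auto
  have L: "((\<lambda>x. Arg (Q x)) \<longlongrightarrow> Arg (d / (a - g s))) (at_left s)"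
    using im' by (intro tendsto_intros tendsto_within_subset[OF Q]) auto
  have eqR: "Arg ((g s - g x) / (a - g x)) = Arg (- Q x)" if "x > s" for x
  proof -
    have "(g s - g x) / (a - g x) = of_real (x - s) * (- Q x)"
      proof -
      have "of_real (x - s) * Q x = (g x - g s) / (a - g x)"
        using that by (simp add: Q_def del: of_real_diff)
      then show ?thesis
        by (metis minus_diff_eq minus_divide_left mult_minus_right)
    qed
    then show ?thesis using that Arg_times_of_real[of "x - s" "- Q x"] by (simp del: of_real_diff)
  qed
  have eqL: "Arg ((g s - g x) / (a - g x)) = Arg (Q x)" if "x < s" for x
  proof -
    have "(g s - g x) / (a - g x) = of_real (s - x) * Q x"
    proof -
      have "of_real (s - x) * Q x = - (of_real (x - s) * Q x)" by (simp add: algebra_simps)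
      also have "of_real (x - s) * Q x = (g x - g s) / (a - g x)"
        using that by (simp add: Q_def del: of_real_diff)
      finally show ?thesis by (metis minus_diff_eq minus_divide_left)
    qed
    then show ?thesis using that Arg_times_of_real[of "s - x" "Q x"] by (simp del: of_real_diff)
  qed
  show r: "((\<lambda>x. Arg ((g s - g x) / (a - g x))) \<longlongrightarrow> Arg (- (d / (a - g s)))) (at_right s)"
    by (rule Lim_transform_eventually[OF R])
      (auto simp: eventually_at_filter eqR)
  show l: "((\<lambda>x. Arg ((g s - g x) / (a - g x))) \<longlongrightarrow> Arg (d / (a - g s))) (at_left s)"
    by (rule Lim_transform_eventually[OF L])
      (auto simp: eventually_at_filter eqL)
  \<comment> \<open>Inversion negates \<open>Arg\<close> only off the negative real axis, where
    \<open>Arg\<close> would be pi on both sides.\<close>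
  have inv: "Arg ((a - g x) / (g s - g x)) = - Arg ((g s - g x) / (a - g x))"
    if "(g s - g x) / (a - g x) \<notin> \<real>\<^sub>\<le>\<^sub>0" for x
  proof (cases "(g s - g x) / (a - g x) \<in> \<real>")
    case True
    then obtain r where "(g s - g x) / (a - g x) = of_real r" by (auto elim: Reals_cases)
    moreover from this have "(a - g x) / (g s - g x) = of_real (inverse r)"
      by (metis inverse_divide of_real_inverse)
    ultimately show ?thesis using that by (simp del: of_real_inverse)
  next
    case False
    then show ?thesis using Arg_inverse[of "(g s - g x) / (a - g x)"] by simp
  qed
  have ev: "\<forall>\<^sub>F x in at s. Im (Q x) \<noteq> 0"
    using tendsto_imp_eventually_ne[OF tendsto_Im[OF Q] im] .
  have ne: "(g s - g x) / (a - g x) \<notin> \<real>\<^sub>\<le>\<^sub>0" if "Im (Q x) \<noteq> 0" "x \<noteq> s" for x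
  proof -
    have "(g s - g x) / (a - g x) = of_real (x - s) * (- Q x)"
      proof -
      have "of_real (x - s) * Q x = (g x - g s) / (a - g x)"
        using that by (simp add: Q_def del: of_real_diff)
      then show ?thesis
        by (metis minus_diff_eq minus_divide_left mult_minus_right)
    qed
    then have "Im ((g s - g x) / (a - g x)) \<noteq> 0"
      using that by simp
    then show ?thesis by (simp add: complex_nonpos_Reals_iff)
  qed
  have ev': "\<forall>\<^sub>F x in at s. - Arg ((g s - g x) / (a - g x)) = Arg ((a - g x) / (g s - g x))"
    using ev unfolding eventually_at_filter by eventually_elim (use inv ne in auto)
  show "((\<lambda>x. Arg ((a - g x) / (g s - g x))) \<longlongrightarrow> - Arg (- (d / (a - g s)))) (at_right s)"
    by (rule Lim_transform_eventually[OF tendsto_minus[OF r]])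
      (rule filter_leD[OF _ ev'], simp add: at_le)
  show "((\<lambda>x. Arg ((a - g x) / (g s - g x))) \<longlongrightarrow> - Arg (d / (a - g s))) (at_left s)"
    by (rule Lim_transform_eventually[OF tendsto_minus[OF l]])
      (rule filter_leD[OF _ ev'], simp add: at_le)
qed

section \<open>The jump of the winding number at a transverse crossing\<close>

text \<open>
  Near the crossing \<open>c\<close> runs in a thin double cone around its tangent, which \<open>g\<close> avoids. The two arcs of
  \<open>c\<close> in the two halves \<open>K1\<close>, \<open>K2\<close> of the cone contribute two angles to the winding number, whose
  one-sided limits differ by \<open>pi\<close> each; the contribution of the rest of \<open>c\<close> is continuous.
\<close>

lemma winding_number_jump:
  fixes c g :: "real \<Rightarrow> complex"
  assumes c: "simple_path c" "valid_path c" and t: "0 < t" "t < 1"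
    and cd: "(c has_vector_derivative u) (at t)" "u \<noteq> 0"
    and gd: "(g has_vector_derivative d) (at s)" and gs: "g s = c t"
    and pos: "Im (d / u) > 0"
  obtains l where "((\<lambda>x. Re (winding_number c (g x))) \<longlongrightarrow> l + 1) (at_right s)"
    and "((\<lambda>x. Re (winding_number c (g x))) \<longlongrightarrow> l) (at_left s)"
    and "\<forall>\<^sub>F x in at s. g x \<notin> path_image c"
proof -
  \<comment> \<open>Any positive slope that keeps \<open>d\<close> outside the double cone would do;
    the summand 1 makes the denominator positive and the inequality strict.\<close>
  define e where "e = Im (d / u) / (\<bar>Re (d / u)\<bar> + 1)"
  have e: "e > 0"
    using pos by (auto simp: e_def intro!: divide_pos_pos)
  have ed: "e * \<bar>Re (d / u)\<bar> < Im (d / u)"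
    using pos unfolding e_def by (simp add: field_simps)
  have "\<forall>\<^sub>F x in at t. \<bar>Im ((c x - c t) / u)\<bar> \<le> e * (sgn (x - t) * Re ((c x - c t) / u))
      \<and> c x \<noteq> c t"
    using eventually_in_sector[OF cd e] by eventually_elim auto
  then obtain r where r: "r > 0" "\<And>x. x \<noteq> t \<Longrightarrow> \<bar>x - t\<bar> < r \<Longrightarrow>
      \<bar>Im ((c x - c t) / u)\<bar> \<le> e * (sgn (x - t) * Re ((c x - c t) / u)) \<and> c x \<noteq> c t"
    unfolding eventually_at by (auto simp: dist_real_def)
  \<comment> \<open>Halving makes all bounds strict: the arc over \<open>{t - h..t + h}\<close>
    stays in the double cone and away from the end points of \<open>c\<close>.\<close>
  define h where "h = min r (min t (1 - t)) / 2"
  have h: "h > 0" "h < r" "h < t" "h < 1 - t"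
    using r(1) t by (auto simp: h_def)
  let ?K1 = "{w. \<bar>Im ((w - g s) / - u)\<bar> \<le> e * Re ((w - g s) / - u)}"
  let ?K2 = "{w. \<bar>Im ((w - g s) / u)\<bar> \<le> e * Re ((w - g s) / u)}"
  define a b where "a = c (t - h)" and "b = c (t + h)"
  have K1: "path_image (subpath (t - h) t c) \<subseteq> ?K1"
  proof -
    have "c x \<in> ?K1" if "x \<in> {t - h..t}" for x
      using r(2)[of x] that h by (cases "x = t") (auto simp: gs sgn_if)
    then show ?thesis using h by (auto simp: path_image_subpath)
  qed
  have K2: "path_image (subpath t (t + h) c) \<subseteq> ?K2"
  proof -
    have "c x \<in> ?K2" if "x \<in> {t..t + h}" for x
      using r(2)[of x] that h by (cases "x = t") (auto simp: gs sgn_if)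
    then show ?thesis using h by (auto simp: path_image_subpath)
  qed
  have a: "a \<in> ?K1" "a \<noteq> g s" and b: "b \<in> ?K2" "b \<noteq> g s"
    using r(2)[of "t - h"] r(2)[of "t + h"] h by (auto simp: a_def b_def gs)
  \<comment> \<open>The incoming arc lies in the half cone around \<open>- u\<close>, so both
    \<open>d\<close> and \<open>u\<close> are negated.\<close>
  have "Im ((- d) / (a - g s)) > 0"
    by (rule Im_pos_divide_sector[of "a - g s" "- u" e]) (use a ed e in auto)
  then have ad: "Im (- (d / (a - g s))) > 0" by simp
  have bd: "Im (d / (b - g s)) > 0"
    by (rule Im_pos_divide_sector[of "b - g s" u e]) (use b ed e in auto)
  \<comment> \<open>\<open>loop_free\<close> permits only the coincidence of the two end points,
    which does not involve the interior parameter \<open>t\<close>.\<close>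
  have inj: "c x \<noteq> c t" if "0 \<le> x" "x \<le> 1" "x \<noteq> t" for x
    using c(1) that t unfolding simple_path_def loop_free_def by force
  let ?A = "subpath 0 (t - h) c" and ?B = "subpath (t + h) 1 c"
  have nAB: "g s \<notin> path_image ?A" "g s \<notin> path_image ?B"
  proof -
    have "c t \<notin> c ` ({0..t - h} \<union> {t + h..1})"
    proof
      assume "c t \<in> c ` ({0..t - h} \<union> {t + h..1})"
      then obtain x where "x \<in> {0..t - h} \<union> {t + h..1}" "c x = c t" by (metis imageE)
      then show False using inj[of x] h t by auto
    qed
    then show "g s \<notin> path_image ?A" "g s \<notin> path_image ?B"
      using h by (simp_all add: path_image_subpath gs image_Un)
  qed
  have pc: "path c" using c(1) simple_path_imp_path by blast
  have pAB: "path ?A" "path ?B" using pc h by (auto intro!: path_subpath)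
  have cont: "(g \<longlongrightarrow> g s) (at s)"
    using gd has_vector_derivative_continuous continuous_at isCont_def by blast
  \<comment> \<open>The arcs outside the double cone avoid \<open>g s\<close>, so their
    contributions are continuous there and cannot jump.\<close>
  have W: "((\<lambda>x. winding_number ?A (g x)) \<longlongrightarrow> winding_number ?A (g s)) (at s)"
    "((\<lambda>x. winding_number ?B (g x)) \<longlongrightarrow> winding_number ?B (g s)) (at s)"
    using continuous_at_winding_number[OF pAB(1) nAB(1)] continuous_at_winding_number[OF pAB(2) nAB(2)]
    by (auto intro: isCont_tendsto_compose[OF _ cont])
  have evK: "\<forall>\<^sub>F x in at s. g x \<notin> ?K1 \<and> g x \<notin> ?K2"
    using eventually_not_in_sector[OF gd ed]
  proof eventually_elim
    case (elim x)
    then have "e * Re ((g x - g s) / u) < \<bar>Im ((g x - g s) / u)\<bar>"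
      "e * - Re ((g x - g s) / u) < \<bar>Im ((g x - g s) / u)\<bar>"
      using e by (smt (verit) mult_left_mono)+
    then show ?case by simp
  qed
  have evAB: "\<forall>\<^sub>F x in at s. g x \<notin> path_image ?A \<and> g x \<notin> path_image ?B"
  proof -
    have "open (- path_image ?A)" "open (- path_image ?B)"
      using pAB by (auto simp: closed_path_image)
    then have "open (- path_image ?A \<inter> - path_image ?B)" by blast
    from topological_tendstoD[OF cont this] nAB show ?thesis by simp
  qed
  have image: "path_image c = path_image ?A \<union> path_image (subpath (t - h) t c)
      \<union> path_image (subpath t (t + h) c) \<union> path_image ?B"
  proof -
    have "{0..1} = {0..t - h} \<union> {t - h..t} \<union> {t..t + h} \<union> {t + h..1}"
      using h t by auto
    then show ?thesis
      using h t by (simp add: path_image_subpath image_Un path_image_def[of c])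
  qed
  have off: "\<forall>\<^sub>F x in at s. g x \<notin> path_image c"
    using evK evAB by eventually_elim (use K1 K2 image in blast)
  let ?R = "\<lambda>x. Re (winding_number ?A (g x)) + Re (winding_number ?B (g x))
      + Arg ((g s - g x) / (a - g x)) / (2 * pi) + Arg ((b - g x) / (g s - g x)) / (2 * pi)"
  have eq: "\<forall>\<^sub>F x in at s. ?R x = Re (winding_number c (g x))"
    using evK off
  proof eventually_elim
    case (elim x)
    let ?z = "g x"
    have z: "?z \<notin> path_image c" by fact
    have "winding_number c ?z = winding_number (subpath 0 1 c) ?z" by simp
    also have "\<dots> = winding_number ?A ?z + winding_number (subpath (t - h) 1 c) ?z"
      using h t by (intro winding_number_subpath_combine[symmetric] pc z) auto
    also have "winding_number (subpath (t - h) 1 c) ?z =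
        winding_number (subpath (t - h) t c) ?z + winding_number (subpath t 1 c) ?z"
      using h t by (intro winding_number_subpath_combine[symmetric] pc z) auto
    also have "winding_number (subpath t 1 c) ?z =
        winding_number (subpath t (t + h) c) ?z + winding_number ?B ?z"
      using h t by (intro winding_number_subpath_combine[symmetric] pc z) auto
    finally have sum: "winding_number c ?z = winding_number ?A ?z + (winding_number (subpath (t - h) t c) ?z
        + (winding_number (subpath t (t + h) c) ?z + winding_number ?B ?z))" .
    have v: "valid_path (subpath (t - h) t c)" "valid_path (subpath t (t + h) c)"
      using h t c by (auto intro!: valid_path_subpath)
    have "Re (winding_number (subpath (t - h) t c) ?z) = Arg ((g s - ?z) / (a - ?z)) / (2 * pi)"
      using Re_winding_number_convex[OF v(1) K1 convex_sector, of ?z] elim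
      by (simp add: a_def gs)
    moreover have "Re (winding_number (subpath t (t + h) c) ?z) = Arg ((b - ?z) / (g s - ?z)) / (2 * pi)"
      using Re_winding_number_convex[OF v(2) K2 convex_sector, of ?z] elim
      by (simp add: b_def gs)
    ultimately show ?case
      unfolding sum by simp
  qed
  have rl: "at_right s \<le> at s" "at_left s \<le> at s" by (simp_all add: at_le)
  have ne: "Im (d / (a - g s)) \<noteq> 0" "Im (d / (b - g s)) \<noteq> 0" using ad bd by auto
  note lima = tendsto_Arg_quotient(1,2)[OF gd a(2) ne(1)]
  note limb = tendsto_Arg_quotient(3,4)[OF gd b(2) ne(2)]
  define m where "m = Re (winding_number ?A (g s)) + Re (winding_number ?B (g s))"
  have "(?R \<longlongrightarrow> m + Arg (- (d / (a - g s))) / (2 * pi) + - Arg (- (d / (b - g s))) / (2 * pi)) (at_right s)"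
    unfolding m_def
    by (intro tendsto_add tendsto_divide tendsto_Re tendsto_const lima limb W[THEN tendsto_mono[OF rl(1)]])
      simp_all
  from Lim_transform_eventually[OF this filter_leD[OF rl(1) eq]]
  have right: "((\<lambda>x. Re (winding_number c (g x))) \<longlongrightarrow>
      m + Arg (- (d / (a - g s))) / (2 * pi) + - Arg (- (d / (b - g s))) / (2 * pi)) (at_right s)" .
  have "(?R \<longlongrightarrow> m + Arg (d / (a - g s)) / (2 * pi) + - Arg (d / (b - g s)) / (2 * pi)) (at_left s)"
    unfolding m_def
    by (intro tendsto_add tendsto_divide tendsto_Re tendsto_const lima limb W[THEN tendsto_mono[OF rl(2)]])
      simp_all
  from Lim_transform_eventually[OF this filter_leD[OF rl(2) eq]]
  have left: "((\<lambda>x. Re (winding_number c (g x))) \<longlongrightarrow>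
      m + Arg (d / (a - g s)) / (2 * pi) + - Arg (d / (b - g s)) / (2 * pi)) (at_left s)" .
  \<comment> \<open>Each of the two angles increases by pi from left to right, which gives
    \<open>2 * pi\<close> together, that is, one turn.\<close>
  have Aa: "Arg (d / (a - g s)) = Arg (- (d / (a - g s))) - pi"
    using Arg_uminus_of_Im_pos[OF ad] by simp
  have Ab: "Arg (- (d / (b - g s))) = Arg (d / (b - g s)) - pi"
    using Arg_uminus_of_Im_pos[OF bd] .
  have "m + Arg (- (d / (a - g s))) / (2 * pi) + - Arg (- (d / (b - g s))) / (2 * pi)
      = (m + Arg (d / (a - g s)) / (2 * pi) + - Arg (d / (b - g s)) / (2 * pi)) + 1"
    by (simp add: Aa Ab diff_divide_distrib)
  with right have "((\<lambda>x. Re (winding_number c (g x))) \<longlongrightarrow>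
     (m + Arg (d / (a - g s)) / (2 * pi) + - Arg (d / (b - g s)) / (2 * pi)) + 1) (at_right s)" by (simp only:)
  from that[OF this left off] show ?thesis .
qed

section \<open>Interior and exterior on the two sides of a crossing\<close>

lemma ccw_inside_outside:
  assumes c: "ccw_simple_closed_curve c" and z: "z \<notin> path_image c"
  shows "z \<in> inside (path_image c) \<and> winding_number c z = 1
    \<or> z \<in> outside (path_image c) \<and> winding_number c z = 0"
proof -
  have "z \<in> inside (path_image c) \<union> outside (path_image c)"
    using z by (simp add: inside_Un_outside)
  moreover have "path c" "pathfinish c = pathstart c"
    using c unfolding ccw_simple_closed_curve_def
    by (auto simp: simple_path_imp_path pathfinish_def pathstart_def) (metis add_0)
  ultimately show ?thesis
    using c winding_number_zero_in_outside unfolding ccw_simple_closed_curve_def by blast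
qed

text \<open>The one-sided limits \<open>l\<close> and \<open>l + 1\<close> both lie in the closed
  set {0, 1} of possible winding numbers, which forces \<open>l = 0\<close>. The threshold 1/2 then
  tells exterior from interior on each side.\<close>

lemma crossing_enters_interior:
  assumes c: "ccw_simple_closed_curve c" and t: "0 < t" "t < 1"
    and cd: "(c has_vector_derivative u) (at t)" "u \<noteq> 0"
    and gd: "(g has_vector_derivative d) (at s)" and gs: "g s = c t"
    and pos: "Im (d / u) > 0"
  shows "\<forall>\<^sub>F x in at_right s. g x \<in> inside (path_image c)"
    and "\<forall>\<^sub>F x in at_left s. g x \<in> outside (path_image c)"
proof -
  have sc: "simple_path c" "valid_path c"
    using c unfolding ccw_simple_closed_curve_def by auto
  let ?w = "\<lambda>x. Re (winding_number c (g x))"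
  obtain l where r: "(?w \<longlongrightarrow> l + 1) (at_right s)" and l: "(?w \<longlongrightarrow> l) (at_left s)"
    and off: "\<forall>\<^sub>F x in at s. g x \<notin> path_image c"
    using winding_number_jump[OF sc t cd gd gs pos] by blast
  have offr: "\<forall>\<^sub>F x in at_right s. g x \<notin> path_image c"
    and offl: "\<forall>\<^sub>F x in at_left s. g x \<notin> path_image c"
    by (rule filter_leD[OF _ off], simp add: at_le)+
  have "\<forall>\<^sub>F x in at_right s. ?w x \<in> {0, 1}"
    using offr by eventually_elim (use ccw_inside_outside[OF c] in force)
  from Lim_in_closed_set[OF _ this _ r] have "l + 1 \<in> {0, 1}" by simp
  moreover have "\<forall>\<^sub>F x in at_left s. ?w x \<in> {0, 1}"
    using offl by eventually_elim (use ccw_inside_outside[OF c] in force)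
  from Lim_in_closed_set[OF _ this _ l] have "l \<in> {0, 1}" by simp
  ultimately have "l = 0" by auto
  then have "\<forall>\<^sub>F x in at_right s. ?w x > 1 / 2"
    using order_tendstoD(1)[OF r, of "1 / 2"] by simp
  with offr show "\<forall>\<^sub>F x in at_right s. g x \<in> inside (path_image c)"
    by eventually_elim (use ccw_inside_outside[OF c] in force)
  have "\<forall>\<^sub>F x in at_left s. ?w x < 1 / 2"
    using order_tendstoD(2)[OF l, of "1 / 2"] \<open>l = 0\<close> by simp
  with offl show "\<forall>\<^sub>F x in at_left s. g x \<in> outside (path_image c)"
    by eventually_elim (use ccw_inside_outside[OF c] in force)
qed

section \<open>Periodic parametrisations and change of base point\<close>

lemma periodic_add_int:
  fixes c :: "real \<Rightarrow> 'a"
  assumes "\<And>t. c (t + 1) = c t"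
  shows "c (t + of_int n) = c t"
proof (induction n rule: int_induct[where k = 0])
  case base
  then show ?case by simp
next
  case (step1 i)
  then show ?case using assms[of "t + of_int i"] by (simp add: add.assoc)
next
  case (step2 i)
  then show ?case using assms[of "t + of_int (i - 1)"] by (simp add: add.assoc)
qed

lemma ccw_periodic:
  "ccw_simple_closed_curve c \<Longrightarrow> c (t + 1) = c t"
  by (simp add: ccw_simple_closed_curve_def)

lemma ccw_frac:
  assumes "ccw_simple_closed_curve c"
  shows "c (frac t) = c t"
  using periodic_add_int[of c "frac t" "\<lfloor>t\<rfloor>"] ccw_periodic[OF assms] by (simp add: frac_def)

lemma ccw_in_path_image:
  assumes "ccw_simple_closed_curve c"
  shows "c t \<in> path_image c"
proof -
  have "c (frac t) \<in> path_image c"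
    unfolding path_image_def by (rule imageI) (simp add: frac_lt_1 less_imp_le)
  then show ?thesis by (simp add: ccw_frac[OF assms])
qed

text \<open>Both parameters reduce to \<open>{0..<1}\<close>, where the end point exception of
  \<open>loop_free\<close> cannot occur. They then differ by an integer of absolute value less than
  1.\<close>

lemma ccw_inj:
  assumes c: "ccw_simple_closed_curve c" and eq: "c s = c t" and st: "\<bar>s - t\<bar> < 1"
  shows "s = t"
proof -
  have "loop_free c"
    using c by (simp add: ccw_simple_closed_curve_def simple_path_def)
  moreover have "c (frac s) = c (frac t)"
    using eq by (simp add: ccw_frac[OF c])
  moreover have "frac s \<in> {0..1}" "frac t \<in> {0..1}"
    by (simp_all add: frac_lt_1 less_imp_le)
  ultimately have "frac s = frac t \<or> frac s = 0 \<and> frac t = 1 \<or> frac s = 1 \<and> frac t = 0"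
    unfolding loop_free_def by blast
  then have "frac s = frac t"
    using frac_lt_1[of s] frac_lt_1[of t] by auto
  then have "s - t = of_int (\<lfloor>s\<rfloor> - \<lfloor>t\<rfloor>)"
    by (simp add: frac_def)
  moreover from this have "\<bar>\<lfloor>s\<rfloor> - \<lfloor>t\<rfloor>\<bar> < 1"
    using st by linarith
  ultimately show ?thesis by simp
qed

text \<open>On the unit interval a translate is a \<open>shiftpath\<close>, which also agrees with
  it elsewhere by periodicity. It serves to move any given parameter to 1/2, away from the base
  point.\<close>

lemma ccw_shift:
  assumes c: "ccw_simple_closed_curve c"
  shows "ccw_simple_closed_curve (\<lambda>t. c (t + a))" "path_image (\<lambda>t. c (t + a)) = path_image c"
proof -
  have per: "c (t + 1) = c t" for t
    using ccw_periodic[OF c] .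
  \<comment> \<open>The \<open>shiftpath\<close> lemmas need a shift in the unit interval; whole
    periods change nothing.\<close>
  let ?b = "frac a"
  have b: "?b \<in> {0..1}" by (simp add: frac_lt_1 less_imp_le)
  have eq: "(\<lambda>t. c (t + a)) = shiftpath ?b c"
  proof
    fix t
    have "c (t + a) = c (?b + t)"
      using periodic_add_int[of c "?b + t" "\<lfloor>a\<rfloor>"] per by (simp add: frac_def algebra_simps)
    moreover have "c (?b + t - 1) = c (?b + t)"
      using per[of "?b + t - 1"] by simp
    ultimately show "c (t + a) = shiftpath ?b c t"
      by (simp add: shiftpath_def)
  qed
  have sc: "simple_path c" "valid_path c" "path c"
    using c unfolding ccw_simple_closed_curve_def by (auto simp: simple_path_imp_path)
  have loop: "pathfinish c = pathstart c"
    using per[of 0] by (simp add: pathfinish_def pathstart_def)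
  show im: "path_image (\<lambda>t. c (t + a)) = path_image c"
    unfolding eq by (rule path_image_shiftpath[OF b loop])
  have "winding_number (\<lambda>t. c (t + a)) z = 1" if "z \<in> inside (path_image c)" for z
  proof -
    have "z \<notin> path_image c" using that by (meson disjoint_iff inside_no_overlap)
    then show ?thesis
      unfolding eq using winding_number_shiftpath[OF sc(3) _ loop b, of z] c that
      by (simp add: ccw_simple_closed_curve_def)
  qed
  moreover have "simple_path (\<lambda>t. c (t + a))" "valid_path (\<lambda>t. c (t + a))"
    unfolding eq using b sc loop by (auto intro!: simple_path_shiftpath valid_path_shiftpath)
  moreover have "c (t + 1 + a) = c (t + a)" for t
    using per[of "t + a"] by (simp add: algebra_simps)
  ultimately show "ccw_simple_closed_curve (\<lambda>t. c (t + a))"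
    unfolding ccw_simple_closed_curve_def im by simp
qed

lemma has_vector_derivative_shift:
  assumes "(c has_vector_derivative u) (at (t + a))"
  shows "((\<lambda>x. c (x + a)) has_vector_derivative u) (at t)"
proof -
  have "((\<lambda>x. x + a) has_vector_derivative 1) (at t)"
    by (auto intro!: derivative_eq_intros)
  from vector_diff_chain_at[OF this assms] show ?thesis by (simp add: o_def)
qed

section \<open>Crossings at arbitrary parameters and alternation of signs\<close>

text \<open>Translating the parameter of \<open>c\<close> puts the crossing at 1/2, so that it may
  also occur at the base point.\<close>

lemma crossing_sides_pos:
  assumes c: "ccw_simple_closed_curve c"
    and cd: "(c has_vector_derivative u) (at t)" "u \<noteq> 0"
    and gd: "(g has_vector_derivative d) (at s)" and gs: "g s = c t"
    and pos: "Im (d / u) > 0"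
  shows "\<forall>\<^sub>F x in at_right s. g x \<in> inside (path_image c)"
    and "\<forall>\<^sub>F x in at_left s. g x \<in> outside (path_image c)"
proof -
  let ?c = "\<lambda>x. c (x + (t - 1 / 2))"
  have "(?c has_vector_derivative u) (at (1 / 2))"
    using cd(1) by (intro has_vector_derivative_shift) simp
  from crossing_enters_interior[OF ccw_shift(1)[OF c] _ _ this cd(2) gd _ pos]
  show "\<forall>\<^sub>F x in at_right s. g x \<in> inside (path_image c)"
    and "\<forall>\<^sub>F x in at_left s. g x \<in> outside (path_image c)"
    by (simp_all add: ccw_shift(2)[OF c] gs)
qed

text \<open>Reversing \<open>g\<close> negates its derivative and exchanges the two sides of
  \<open>s\<close>, which reduces this to the positive case.\<close>

lemma crossing_sides_neg:
  assumes c: "ccw_simple_closed_curve c"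
    and cd: "(c has_vector_derivative u) (at t)" "u \<noteq> 0"
    and gd: "(g has_vector_derivative d) (at s)" and gs: "g s = c t"
    and neg: "Im (d / u) < 0"
  shows "\<forall>\<^sub>F x in at_right s. g x \<in> outside (path_image c)"
    and "\<forall>\<^sub>F x in at_left s. g x \<in> inside (path_image c)"
proof -
  have "((\<lambda>x. - x) has_vector_derivative -1) (at (- s))"
    by (auto intro!: derivative_eq_intros)
  from vector_diff_chain_at[OF this, of g d] gd
  have "((\<lambda>x. g (- x)) has_vector_derivative - d) (at (- s))" by (simp add: o_def)
  from crossing_sides_pos[OF c cd this] gs neg
  have "\<forall>\<^sub>F x in at_right (- s). g (- x) \<in> inside (path_image c)"
    and "\<forall>\<^sub>F x in at_left (- s). g (- x) \<in> outside (path_image c)" by simp_all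
  then show "\<forall>\<^sub>F x in at_right s. g x \<in> outside (path_image c)"
    and "\<forall>\<^sub>F x in at_left s. g x \<in> inside (path_image c)"
    by (simp_all add: at_left_minus[of s] at_right_minus[of s] eventually_filtermap)
qed

text \<open>With equal signs, \<open>g\<close> would start its passage on one side of
  \<open>c\<close> and end it on the other, although the connected image of the open interval misses
  \<open>c\<close>.\<close>

lemma crossing_signs_alternate:
  assumes c: "ccw_simple_closed_curve c"
    and c0: "(c has_vector_derivative u0) (at t0)" "u0 \<noteq> 0"
    and c1: "(c has_vector_derivative u1) (at t1)" "u1 \<noteq> 0"
    and g0: "(g has_vector_derivative d0) (at s0)" "g s0 = c t0" "Im (d0 / u0) \<noteq> 0"
    and g1: "(g has_vector_derivative d1) (at s1)" "g s1 = c t1" "Im (d1 / u1) \<noteq> 0"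
    and s: "s0 < s1" and cont: "continuous_on {s0<..<s1} g"
    and off: "\<And>x. x \<in> {s0<..<s1} \<Longrightarrow> g x \<notin> path_image c"
  shows "sgn (Im (d0 / u0)) = - sgn (Im (d1 / u1))"
proof (rule ccontr)
  assume *: "sgn (Im (d0 / u0)) \<noteq> - sgn (Im (d1 / u1))"
  let ?I = "inside (path_image c)" and ?O = "outside (path_image c)"
  have cl: "closed (path_image c)"
    using c by (simp add: ccw_simple_closed_curve_def closed_path_image simple_path_imp_path)
  have "connected (g ` {s0<..<s1})"
    by (intro connected_continuous_image cont) simp
  moreover have "g ` {s0<..<s1} \<subseteq> ?I \<union> ?O"
    using off by (auto simp: inside_Un_outside)
  ultimately have dis: "?I \<inter> g ` {s0<..<s1} = {} \<or> ?O \<inter> g ` {s0<..<s1} = {}"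
    by (intro connectedD) (auto simp: cl open_inside open_outside inside_Int_outside)
  have right: "\<exists>x\<in>{s0<..<s1}. P x" if "\<forall>\<^sub>F x in at_right s0. P x" for P
  proof -
    have "\<forall>\<^sub>F x in at_right s0. P x \<and> x \<in> {s0<..<s1}"
      using that eventually_at_right_real[OF s] by eventually_elim auto
    then show ?thesis
      using eventually_happens'[of "at_right s0"] by (force simp: trivial_limit_at_right_real)
  qed
  have left: "\<exists>x\<in>{s0<..<s1}. P x" if "\<forall>\<^sub>F x in at_left s1. P x" for P
  proof -
    have "\<forall>\<^sub>F x in at_left s1. P x \<and> x \<in> {s0<..<s1}"
      using that eventually_at_left_real[OF s] by eventually_elim auto
    then show ?thesis
      using eventually_happens'[of "at_left s1"] by (force simp: trivial_limit_at_left_real)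
  qed
  consider "Im (d0 / u0) > 0" "Im (d1 / u1) > 0" | "Im (d0 / u0) < 0" "Im (d1 / u1) < 0"
    using * g0(3) g1(3) by (auto simp: sgn_if split: if_splits)
  then show False
  proof cases
    case 1
    show ?thesis
      using right[OF crossing_sides_pos(1)[OF c c0 g0(1,2) 1(1)]]
        left[OF crossing_sides_pos(2)[OF c c1 g1(1,2) 1(2)]] dis by blast
  next
    case 2
    show ?thesis
      using right[OF crossing_sides_neg(1)[OF c c0 g0(1,2) 2(1)]]
        left[OF crossing_sides_neg(2)[OF c c1 g1(1,2) 2(2)]] dis by blast
  qed
qed

section \<open>Cyclic successors on one curve\<close>

lemma param_props:
  assumes c: "ccw_simple_closed_curve c" and p: "p \<in> path_image c"
  shows "0 \<le> param c p" "param c p < 1" "c (param c p) = p"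
proof -
  obtain x where "c x = p" using p by (auto simp: path_image_def)
  then have "0 \<le> frac x \<and> frac x < 1 \<and> c (frac x) = p"
    by (simp add: frac_lt_1 ccw_frac[OF c])
  moreover have "s = t" if "0 \<le> s \<and> s < 1 \<and> c s = p" "0 \<le> t \<and> t < 1 \<and> c t = p" for s t
    using ccw_inj[OF c, of s t] that by auto
  ultimately have "\<exists>!t. 0 \<le> t \<and> t < 1 \<and> c t = p" by blast
  from theI'[OF this] show "0 \<le> param c p" "param c p < 1" "c (param c p) = p"
    unfolding param_def by auto
qed

text \<open>This is the first parameter after that of \<open>p\<close> at which the curve reaches
  \<open>q\<close>, a full period later if the points coincide. It replaces cyclic order by the
  order of the reals.\<close>

definition next_param :: "(real \<Rightarrow> complex) \<Rightarrow> complex \<Rightarrow> complex \<Rightarrow> real" where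
  "next_param c p q = (if param c p < param c q then param c q else param c q + 1)"

lemma arc_ccw_next_param: "arc_ccw c p q = c ` {param c p .. next_param c p q}"
  by (simp add: arc_ccw_def next_param_def)

lemma next_param_props:
  assumes c: "ccw_simple_closed_curve c" and "p \<in> path_image c" "q \<in> path_image c"
  shows "param c p < next_param c p q" "next_param c p q \<le> param c p + 1" "c (next_param c p q) = q"
  using param_props[OF c assms(2)] param_props[OF c assms(3)] ccw_periodic[OF c]
  by (auto simp: next_param_def)

lemma adj_ccw_eq_1_iff:
  "adj_ccw P c p q = 1 \<longleftrightarrow> (\<forall>r\<in>P. r \<in> arc_ccw c p q \<longrightarrow> r = p \<or> r = q)"
  by (auto simp: adj_ccw_def)

text \<open>As point sets, the clockwise arc from \<open>p\<close> to \<open>q\<close> and the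
  counter-clockwise arc from \<open>q\<close> to \<open>p\<close> coincide: their parameter
  intervals are equal or differ by one period.\<close>

lemma adj_cw_eq_adj_ccw:
  assumes c: "ccw_simple_closed_curve c"
  shows "adj_cw P c p q = adj_ccw P c q p"
proof -
  have "c ` {b - 1..a} = c ` {b..a + 1}" for a b
  proof -
    have "c ` {b..a + 1} = c ` ((\<lambda>x. x + 1) ` {b - 1..a})" by simp
    also have "\<dots> = c ` {b - 1..a}"
      unfolding image_image by (simp add: ccw_periodic[OF c])
    finally show ?thesis by simp
  qed
  then have "arc_cw c p q = arc_ccw c q p"
    by (auto simp: arc_cw_def arc_ccw_def)
  then show ?thesis
    unfolding adj_cw_def adj_ccw_def by metis
qed

lemma next_param_unique:
  assumes c: "ccw_simple_closed_curve c" and pq: "p \<in> path_image c" "q \<in> path_image c"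
    and s: "param c p < s" "s \<le> param c p + 1" "c s = q"
  shows "s = next_param c p q"
proof -
  have "\<bar>s - next_param c p q\<bar> < 1"
    using next_param_props[OF c pq] s by auto
  then show ?thesis
    using ccw_inj[OF c, of s "next_param c p q"] s(3) next_param_props[OF c pq] by simp
qed

text \<open>Adjacency tolerates \<open>p\<close> and \<open>q\<close> on the arc; injectivity over
  less than a period excludes them strictly between the ends.\<close>

lemma adj_ccw_gap:
  assumes c: "ccw_simple_closed_curve c" and P: "P \<subseteq> path_image c" "p \<in> P" "q \<in> P"
    and adj: "adj_ccw P c p q = 1" and s: "param c p < s" "s < next_param c p q"
  shows "c s \<notin> P"
proof
  assume "c s \<in> P"
  have pq: "p \<in> path_image c" "q \<in> path_image c" using P by auto
  note np = next_param_props[OF c pq] and pp = param_props[OF c pq(1)]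
  have "c s \<in> arc_ccw c p q"
    using s by (auto simp: arc_ccw_next_param)
  then have "c s = p \<or> c s = q"
    using adj \<open>c s \<in> P\<close> by (auto simp: adj_ccw_eq_1_iff)
  then show False
    using ccw_inj[OF c, of s "param c p"] ccw_inj[OF c, of s "next_param c p q"] np pp s by auto
qed

text \<open>The successor is the point of \<open>P - {p}\<close> that is reached first, that is,
  with least \<open>next_param\<close>.\<close>

lemma adj_ccw_total:
  assumes c: "ccw_simple_closed_curve c" and P: "P \<subseteq> path_image c" "finite P" "p \<in> P"
    and ne: "\<exists>r\<in>P. r \<noteq> p"
  shows "\<exists>q\<in>P. adj_ccw P c p q = 1"
proof -
  let ?t = "next_param c p"
  define q where "q = arg_min_on ?t (P - {p})"
  have fin: "finite (P - {p})" "P - {p} \<noteq> {}" using P ne by auto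
  have q: "q \<in> P" "q \<noteq> p"
    using arg_min_if_finite(1)[OF fin, of ?t] by (auto simp: q_def)
  have min: "?t q \<le> ?t r" if "r \<in> P" "r \<noteq> p" for r
    using arg_min_least[OF fin, of r ?t] that by (auto simp: q_def)
  have "r = q" if r: "r \<in> P" "r \<in> arc_ccw c p q" "r \<noteq> p" for r
  proof -
    obtain s where s: "param c p \<le> s" "s \<le> ?t q" "r = c s"
      using r(2) by (auto simp: arc_ccw_next_param)
    have pqr: "p \<in> path_image c" "q \<in> path_image c" "r \<in> path_image c" using P q r by auto
    have "s \<noteq> param c p" using s(3) r(3) param_props(3)[OF c pqr(1)] by auto
    then have "s = ?t r"
      using s next_param_props(2)[OF c pqr(1,2)] by (intro next_param_unique c pqr) auto
    then have "s = ?t q" using s(2) min[OF r(1,3)] by simp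
    then show ?thesis using s(3) next_param_props(3)[OF c pqr(1,2)] by simp
  qed
  then show ?thesis using q(1) by (auto simp: adj_ccw_eq_1_iff)
qed

text \<open>Of two distinct predecessors, the one farther back from \<open>q\<close> would have the
  other in its gap.\<close>

lemma adj_ccw_left_unique:
  assumes c: "ccw_simple_closed_curve c" and P: "P \<subseteq> path_image c" "p \<in> P" "p' \<in> P" "q \<in> P"
    and adj: "adj_ccw P c p q = 1" "adj_ccw P c p' q = 1"
  shows "p = p'"
proof (rule ccontr)
  assume "p \<noteq> p'"
  have im: "p \<in> path_image c" "p' \<in> path_image c" "q \<in> path_image c" using P by auto
  note pr = param_props[OF c im(1)] param_props[OF c im(2)] param_props[OF c im(3)]
  have gap: "\<not> (param c p < s \<and> s < next_param c p q)" if "c s \<in> P" for s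
    using adj_ccw_gap[OF c P(1,2,4) adj(1)] that by auto
  have gap': "\<not> (param c p' < s \<and> s < next_param c p' q)" if "c s \<in> P" for s
    using adj_ccw_gap[OF c P(1,3,4) adj(2)] that by auto
  have ne: "param c p \<noteq> param c p'" using pr \<open>p \<noteq> p'\<close> by metis
  \<comment> \<open>The translates by a period are needed because a gap may extend past the base
    point.\<close>
  have mem: "c (param c p) \<in> P" "c (param c p + 1) \<in> P" "c (param c p') \<in> P" "c (param c p' + 1) \<in> P"
    using P pr by (simp_all add: ccw_periodic[OF c])
  show False
    using gap[OF mem(3)] gap[OF mem(4)] gap'[OF mem(1)] gap'[OF mem(2)] pr(1,2,4,5,7,8) ne
    unfolding next_param_def by (smt (verit))
qed

section \<open>Continuity, tangents and the signs of successive crossings\<close>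

text \<open>\<open>path\<close> speaks only of the unit interval; translation makes \<open>t\<close>
  the interior parameter 1/2.\<close>

lemma ccw_isCont:
  assumes c: "ccw_simple_closed_curve c"
  shows "isCont c t"
proof -
  let ?a = "t - 1 / 2"
  let ?c = "\<lambda>x. c (x + ?a)"
  have "path ?c"
    using ccw_shift(1)[OF c, of ?a] by (simp add: ccw_simple_closed_curve_def simple_path_imp_path)
  then have "continuous_on {0<..<1} ?c"
    unfolding path_def by (rule continuous_on_subset) auto
  then have "isCont ?c (1 / 2)"
    by (simp add: continuous_on_eq_continuous_at)
  moreover have "isCont (\<lambda>x. x - ?a) t"
    by (intro continuous_intros)
  ultimately show ?thesis
    using isCont_o2[of t "\<lambda>x. x - ?a" ?c] by simp
qed

definition tangent :: "(real \<Rightarrow> complex) \<Rightarrow> complex \<Rightarrow> complex" where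
  "tangent c p = vector_derivative c (at (param c p))"

lemma regular_near_tangent:
  assumes "regular_near c p"
  shows "(c has_vector_derivative tangent c p) (at (param c p))" "tangent c p \<noteq> 0"
proof -
  obtain e where "e > 0" "c C1_differentiable_on {param c p - e <..< param c p + e}"
    "\<forall>t \<in> {param c p - e <..< param c p + e}. vector_derivative c (at t) \<noteq> 0"
    using assms unfolding regular_near_def by auto
  moreover from this have "param c p \<in> {param c p - e <..< param c p + e}" by simp
  ultimately show "(c has_vector_derivative tangent c p) (at (param c p))" "tangent c p \<noteq> 0"
    unfolding tangent_def by (auto simp: C1_differentiable_on_eq vector_derivative_works)
qed

text \<open>The imaginary part of an inverse is the negated imaginary part over a positive number.
  Exchanging the crossing curve and the crossed one thus flips the sign.\<close>

lemma sgn_Im_divide_commute: "sgn (Im (z / w)) = - sgn (Im (w / z))"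
proof (cases "z = 0 \<or> w = 0")
  case False
  have "sgn (Im (inverse x)) = - sgn (Im x)" if "x \<noteq> 0" for x :: complex
  proof -
    have "(Re x)\<^sup>2 + (Im x)\<^sup>2 > 0" using that by (simp add: complex_neq_0)
    then have "sgn ((Re x)\<^sup>2 + (Im x)\<^sup>2) = 1" by simp
    then show ?thesis
      by (simp add: sgn_divide sgn_minus del: sgn_1_pos)
  qed
  from this[of "w / z"] False show ?thesis by simp
qed auto

lemma unit_tangent_divide:
  assumes "tangent c1 p \<noteq> 0" "tangent c2 p \<noteq> 0"
  obtains r where "r > 0" "unit_tangent c2 p / unit_tangent c1 p = of_real r * (tangent c2 p / tangent c1 p)"
proof
  show "norm (tangent c1 p) / norm (tangent c2 p) > 0" using assms by simp
  show "unit_tangent c2 p / unit_tangent c1 p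
      = of_real (norm (tangent c1 p) / norm (tangent c2 p)) * (tangent c2 p / tangent c1 p)"
    using assms by (simp add: unit_tangent_def tangent_def[symmetric] sgn_div_norm scaleR_conv_of_real
        field_simps)
qed

text \<open>The sine of \<open>Arg z\<close> is \<open>Im z / norm z\<close>, and normalising the
  tangents only scales their quotient by a positive factor.\<close>

lemma rho_eq:
  assumes "tangent c1 p \<noteq> 0" "tangent c2 p \<noteq> 0"
  shows "rho c1 c2 p = sgn (Im (tangent c2 p / tangent c1 p))"
proof -
  obtain r where r: "r > 0"
    "unit_tangent c2 p / unit_tangent c1 p = of_real r * (tangent c2 p / tangent c1 p)"
    using unit_tangent_divide[OF assms] .
  define z where "z = tangent c2 p / tangent c1 p"
  have "z \<noteq> 0" using assms by (simp add: z_def)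
  then show ?thesis
    using r(1) unfolding rho_def r(2) z_def[symmetric]
    by (simp add: sin_Arg sgn_divide)
qed

text \<open>A real quotient would make one unit tangent a real multiple of the other. As they are
  distinct, removing one from the pair leaves the other to span it.\<close>

lemma transverse_at_Im:
  assumes "transverse_at c1 c2 p" "tangent c1 p \<noteq> 0" "tangent c2 p \<noteq> 0"
  shows "Im (tangent c2 p / tangent c1 p) \<noteq> 0"
proof
  assume 0: "Im (tangent c2 p / tangent c1 p) = 0"
  obtain r where r: "r > 0"
    "unit_tangent c2 p / unit_tangent c1 p = of_real r * (tangent c2 p / tangent c1 p)"
    using unit_tangent_divide[OF assms(2,3)] .
  then have "Im (unit_tangent c2 p / unit_tangent c1 p) = 0"
    using 0 by (simp del: times_divide_eq_right)
  then obtain k where k: "unit_tangent c2 p / unit_tangent c1 p = of_real k"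
    using complex_is_Real_iff by (auto elim: Reals_cases)
  have ne: "unit_tangent c1 p \<noteq> 0"
    using assms(2) by (simp add: unit_tangent_def tangent_def sgn_zero_iff)
  have "unit_tangent c2 p = k *\<^sub>R unit_tangent c1 p"
    using k ne by (simp add: field_simps scaleR_conv_of_real)
  moreover have neq: "unit_tangent c1 p \<noteq> unit_tangent c2 p"
    and ind: "independent {unit_tangent c1 p, unit_tangent c2 p}"
    using assms(1) by (auto simp: transverse_at_def)
  ultimately have "unit_tangent c2 p \<in> span ({unit_tangent c1 p, unit_tangent c2 p} - {unit_tangent c2 p})"
    by (metis DiffI insertI1 singletonD span_base span_scale)
  with ind show False
    unfolding dependent_def by blast
qed

text \<open>Between the parameters of adjacent crossings \<open>g\<close> meets no point of
  \<open>P\<close>, hence misses \<open>c\<close>, so \<open>crossing_signs_alternate\<close>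
  applies.\<close>

lemma successive_crossings_opposite:
  assumes c: "ccw_simple_closed_curve c" and g: "ccw_simple_closed_curve g"
    and P: "P = path_image c \<inter> path_image g" "p \<in> P" "q \<in> P"
    and reg: "regular_near c p" "regular_near c q" "regular_near g p" "regular_near g q"
    and im: "Im (tangent g p / tangent c p) \<noteq> 0" "Im (tangent g q / tangent c q) \<noteq> 0"
    and adj: "adj_ccw P g p q = 1"
  shows "sgn (Im (tangent g p / tangent c p)) = - sgn (Im (tangent g q / tangent c q))"
proof -
  have pq: "p \<in> path_image c" "q \<in> path_image c" "p \<in> path_image g" "q \<in> path_image g"
    using P by auto
  note np = next_param_props[OF g pq(3,4)]
  have gq: "(g has_vector_derivative tangent g q) (at (next_param g p q))"
  proof (cases "param g p < param g q")
    case True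
    then show ?thesis using regular_near_tangent(1)[OF reg(4)] by (simp add: next_param_def)
  next
    case False
    \<comment> \<open>Here the interval reaches past the base point, so the derivative at
      \<open>param g q\<close> is carried one period further.\<close>
    have "g (x + - 1) = g x" for x
      using ccw_periodic[OF g, of "x - 1"] by simp
    moreover have "((\<lambda>x. g (x + - 1)) has_vector_derivative tangent g q) (at (param g q + 1))"
      using regular_near_tangent(1)[OF reg(4)] by (intro has_vector_derivative_shift) simp
    ultimately show ?thesis using False by (simp add: next_param_def)
  qed
  show ?thesis
  proof (rule crossing_signs_alternate[OF c regular_near_tangent[OF reg(1)] regular_near_tangent[OF reg(2)]
        regular_near_tangent(1)[OF reg(3)] _ im(1) gq _ im(2) np(1)])
    show "g (param g p) = c (param c p)"
      using param_props(3)[OF g pq(3)] param_props(3)[OF c pq(1)] by simp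
    show "g (next_param g p q) = c (param c q)"
      using np(3) param_props(3)[OF c pq(2)] by simp
    show "continuous_on {param g p<..<next_param g p q} g"
      by (intro continuous_at_imp_continuous_on ballI ccw_isCont g)
    show "g x \<notin> path_image c" if "x \<in> {param g p<..<next_param g p q}" for x
      using adj_ccw_gap[OF g _ P(2,3) adj, of x] that P(1) ccw_in_path_image[OF g, of x] by auto
  qed
qed

section \<open>Relations on finite sets and chains of crossings\<close>

text \<open>For a step from \<open>y\<close> to \<open>z\<close>, a choice of successors maps the
  finite set of points reachable from \<open>z\<close> injectively into itself, hence onto itself.
  So \<open>z\<close> has a predecessor in that set, which by uniqueness is
  \<open>y\<close>.\<close>

lemma rtranclp_sym_if_left_unique:
  assumes fin: "finite P" and dom: "\<And>x y. R x y \<Longrightarrow> x \<in> P \<and> y \<in> P"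
    and total: "\<And>x. x \<in> P \<Longrightarrow> \<exists>y. R x y"
    and unique: "\<And>x x' y. R x y \<Longrightarrow> R x' y \<Longrightarrow> x = x'"
    and xy: "R\<^sup>*\<^sup>* x y"
  shows "R\<^sup>*\<^sup>* y x"
  using xy
proof induction
  case (step y z)
  obtain f where f: "\<And>x. x \<in> P \<Longrightarrow> R x (f x)"
    using total by metis
  define S where "S = {w \<in> P. R\<^sup>*\<^sup>* z w}"
  have "f ` S \<subseteq> S"
    using f dom by (auto simp: S_def intro: rtranclp.rtrancl_into_rtrancl)
  moreover have "inj_on f S"
    using f unique by (auto simp: S_def inj_on_def) metis
  moreover have "finite S"
    using fin by (simp add: S_def)
  ultimately have "f ` S = S"
    by (simp add: endo_inj_surj)
  moreover have "z \<in> S"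
    using dom step by (auto simp: S_def)
  ultimately obtain w where "w \<in> S" "z = f w" by auto
  then have "w = y"
    using f[of w] unique step(2) by (auto simp: S_def)
  then have "R\<^sup>*\<^sup>* z y"
    using \<open>w \<in> S\<close> by (simp add: S_def)
  then show ?case
    using step by simp
qed simp

text \<open>An injective choice of successors on a finite set is onto, and left uniqueness then
  leaves no other pairs. This is needed for the second curve, whose successor relation is used in
  reverse.\<close>

lemma left_unique_total_imp_bijective:
  assumes fin: "finite P" and dom: "\<And>x y. R x y \<Longrightarrow> x \<in> P \<and> y \<in> P"
    and total: "\<And>x. x \<in> P \<Longrightarrow> \<exists>y. R x y"
    and unique: "\<And>x x' y. R x y \<Longrightarrow> R x' y \<Longrightarrow> x = x'"
  shows "y \<in> P \<Longrightarrow> \<exists>x. R x y" and "R x y \<Longrightarrow> R x y' \<Longrightarrow> y = y'"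
proof -
  obtain f where f: "\<And>x. x \<in> P \<Longrightarrow> R x (f x)"
    using total by metis
  have "f ` P \<subseteq> P" using f dom by auto
  moreover have "inj_on f P"
    using f unique by (auto simp: inj_on_def) metis
  ultimately have surj: "f ` P = P"
    using fin by (simp add: endo_inj_surj)
  then show "\<exists>x. R x y" if "y \<in> P"
    using f that by (metis imageE)
  have "y = f x" if "R x y" for x y
    using surj f dom unique that by (metis imageE)
  then show "R x y \<Longrightarrow> R x y' \<Longrightarrow> y = y'" by metis
qed

text \<open>A product of factors in {0, 1} equals 1 exactly if every factor does, so the sequences
  are chains of single steps.\<close>

lemma linked_iff_rtranclp:
  fixes c1 c2
  defines "P \<equiv> crossings c1 c2"
  assumes vals: "\<And>p q. p \<in> P \<Longrightarrow> signed_adj c1 c2 p q \<in> {0, 1}" and p: "p \<in> P"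
  shows "linked c1 c2 p q \<longleftrightarrow> (\<lambda>p q. p \<in> P \<and> q \<in> P \<and> signed_adj c1 c2 p q = 1)\<^sup>*\<^sup>* p q"
    (is "_ \<longleftrightarrow> ?R\<^sup>*\<^sup>* p q")
proof
  assume "linked c1 c2 p q"
  then obtain K :: nat and a where K: "K \<ge> 1" "\<forall>k\<in>{1..K}. a k \<in> P" "a 1 = p" "a K = q"
    and prod: "(\<Prod>k\<in>{1..<K}. signed_adj c1 c2 (a k) (a (k + 1))) = 1"
    unfolding linked_def P_def by auto
  have one: "signed_adj c1 c2 (a k) (a (k + 1)) = 1" if "k \<in> {1..<K}" for k
  proof -
    have "signed_adj c1 c2 (a k) (a (k + 1)) \<noteq> 0"
      using prod that by (metis finite_atLeastLessThan prod_zero zero_neq_one)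
    then show ?thesis using vals[of "a k" "a (k + 1)"] K(2) that by auto
  qed
  have "?R\<^sup>*\<^sup>* p (a k)" if "1 \<le> k" "k \<le> K" for k
    using that
  proof (induction k rule: dec_induct)
    case base
    then show ?case using K(3) by simp
  next
    case (step k)
    then have "?R\<^sup>*\<^sup>* p (a k)" by simp
    moreover have "?R (a k) (a (Suc k))"
      using step one[of k] K(2) by auto
    ultimately show ?case
      by (rule rtranclp.rtrancl_into_rtrancl)
  qed
  then show "?R\<^sup>*\<^sup>* p q" using K by auto
next
  assume "?R\<^sup>*\<^sup>* p q"
  then show "linked c1 c2 p q"
  proof induction
    case base
    show ?case
      \<comment> \<open>The one-point sequence has an empty product.\<close>
      unfolding linked_def using p by (intro exI[of _ 1] exI[of _ "\<lambda>_. p"] conjI) (auto simp: P_def)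
  next
    case (step q r)
    then obtain K :: nat and a where K: "K \<ge> 1" "\<forall>k\<in>{1..K}. a k \<in> P" "a 1 = p" "a K = q"
      and prod: "(\<Prod>k\<in>{1..<K}. signed_adj c1 c2 (a k) (a (k + 1))) = 1"
      unfolding linked_def P_def by auto
    define b where "b = a(Suc K := r)"
    have "(\<Prod>k\<in>{1..<Suc K}. signed_adj c1 c2 (b k) (b (k + 1)))
        = (\<Prod>k\<in>{1..<K}. signed_adj c1 c2 (b k) (b (k + 1))) * signed_adj c1 c2 (b K) (b (K + 1))"
      using K(1) by simp
    also have "(\<Prod>k\<in>{1..<K}. signed_adj c1 c2 (b k) (b (k + 1))) = 1"
      unfolding prod[symmetric] by (intro prod.cong) (auto simp: b_def)
    also have "signed_adj c1 c2 (b K) (b (K + 1)) = 1"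
      using step(2) K by (simp add: b_def)
    finally have "(\<Prod>k\<in>{1..<Suc K}. signed_adj c1 c2 (b k) (b (k + 1))) = 1" by simp
    moreover have "\<forall>k\<in>{1..Suc K}. b k \<in> P"
      using K(2) step(2) by (auto simp: b_def le_Suc_eq)
    ultimately show ?case
      unfolding linked_def P_def[symmetric] using K
      by (intro exI[of _ "Suc K"] exI[of _ b]) (auto simp: b_def)
  qed
qed

section \<open>Bijectivity of the signed adjacency and symmetry of the relation\<close>

theorem theorem3p2:
  fixes c1 c2 :: "real \<Rightarrow> complex" and N :: nat and p :: "nat \<Rightarrow> complex"
  assumes "ccw_simple_closed_curve c1" and "ccw_simple_closed_curve c2"
    and "N \<ge> 1"
    and "inj_on p {1..2 * N}"
    and "crossings c1 c2 = p ` {1..2 * N}"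
    and "\<And>i. i \<in> {1..2 * N} \<Longrightarrow> regular_near c1 (p i) \<and> regular_near c2 (p i)"
    and "\<And>i. i \<in> {1..2 * N} \<Longrightarrow> transverse_at c1 c2 (p i)"
  shows "\<forall>i\<in>{1..2 * N}. \<forall>j\<in>{1..2 * N}.
           linked c1 c2 (p i) (p j) \<longrightarrow> linked c1 c2 (p j) (p i)"
proof -
  define P where "P = crossings c1 c2"
  note c = assms(1,2)
  have sub: "P \<subseteq> path_image c1" "P \<subseteq> path_image c2"
    and P_eq: "P = path_image c2 \<inter> path_image c1" "P = path_image c1 \<inter> path_image c2"
    by (auto simp: P_def crossings_def)
  have fin: "finite P"
    by (simp add: P_def assms(5))
  \<comment> \<open>Two crossings guarantee that each has another one to serve as successor.\<close>
  have "card P \<ge> 2"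
    using assms(3,4) by (simp add: P_def assms(5) card_image)
  have other: "\<exists>r\<in>P. r \<noteq> x" for x
  proof (rule ccontr)
    assume "\<not> (\<exists>r\<in>P. r \<noteq> x)"
    then have "P \<subseteq> {x}" by auto
    then have "card P \<le> 1" using card_mono[of "{x}" P] by simp
    with \<open>card P \<ge> 2\<close> show False by simp
  qed
  have reg: "regular_near c1 x" "regular_near c2 x" and tr: "transverse_at c1 c2 x" if "x \<in> P" for x
    using assms(6,7) that by (auto simp: P_def assms(5))
  note tan1 = regular_near_tangent(2)[OF reg(1)] and tan2 = regular_near_tangent(2)[OF reg(2)]
  have im: "Im (tangent c2 x / tangent c1 x) \<noteq> 0" if "x \<in> P" for x
    using transverse_at_Im[OF tr tan1 tan2] that by blast
  have im': "Im (tangent c1 x / tangent c2 x) \<noteq> 0" if "x \<in> P" for x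
    using im[OF that] sgn_Im_divide_commute[of "tangent c1 x" "tangent c2 x"] by (auto simp: sgn_zero_iff)
  \<comment> \<open>The first form reads \<open>c2\<close> as crossing \<open>c1\<close>, the second
    \<open>c1\<close> as crossing \<open>c2\<close>; each suits the walk along one curve.\<close>
  have rho: "rho c1 c2 x = sgn (Im (tangent c2 x / tangent c1 x))"
    "rho c1 c2 x = - sgn (Im (tangent c1 x / tangent c2 x))" if "x \<in> P" for x
    using rho_eq[OF tan1 tan2] that sgn_Im_divide_commute[of "tangent c2 x" "tangent c1 x"] by simp_all
  have rho_cases: "rho c1 c2 x = 1 \<or> rho c1 c2 x = - 1" if "x \<in> P" for x
    using rho(1)[OF that] im[OF that] by (simp add: sgn_if)

  define A1 where "A1 = (\<lambda>x y. x \<in> P \<and> y \<in> P \<and> adj_ccw P c1 x y = 1)"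
  define A2 where "A2 = (\<lambda>x y. x \<in> P \<and> y \<in> P \<and> adj_ccw P c2 x y = 1)"
  have A1: "\<exists>y. A1 x y" if "x \<in> P" for x
    using adj_ccw_total[OF c(1) sub(1) fin that other] that by (auto simp: A1_def)
  have A1_unique: "x = x'" if "A1 x y" "A1 x' y" for x x' y
    using adj_ccw_left_unique[OF c(1) sub(1)] that by (auto simp: A1_def)
  have A2_total: "\<exists>y. A2 x y" if "x \<in> P" for x
    using adj_ccw_total[OF c(2) sub(2) fin that other] that by (auto simp: A2_def)
  have A2_left_unique: "x = x'" if "A2 x y" "A2 x' y" for x x' y
    using adj_ccw_left_unique[OF c(2) sub(2)] that by (auto simp: A2_def)
  have A2_dom: "x \<in> P \<and> y \<in> P" if "A2 x y" for x y
    using that by (simp add: A2_def)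
  have A2: "\<exists>x. A2 x y" if "y \<in> P" for y
    using left_unique_total_imp_bijective(1)[of P A2, OF fin] A2_dom A2_total A2_left_unique that by blast
  have A2_unique: "y = y'" if "A2 x y" "A2 x y'" for x y y'
    using left_unique_total_imp_bijective(2)[of P A2, OF fin] A2_dom A2_total A2_left_unique that by blast
  have A1_rho: "rho c1 c2 x = - rho c1 c2 y" if "A1 x y" for x y
  proof -
    have xy: "x \<in> P" "y \<in> P" "adj_ccw P c1 x y = 1" using that by (auto simp: A1_def)
    show ?thesis
      using successive_crossings_opposite[OF c(2,1) P_eq(1) xy(1,2) reg(2)[OF xy(1)] reg(2)[OF xy(2)]
          reg(1)[OF xy(1)] reg(1)[OF xy(2)] im'[OF xy(1)] im'[OF xy(2)] xy(3)]
      by (simp add: rho(2) xy(1,2))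
  qed
  have A2_rho: "rho c1 c2 x = - rho c1 c2 y" if "A2 x y" for x y
  proof -
    have xy: "x \<in> P" "y \<in> P" "adj_ccw P c2 x y = 1" using that by (auto simp: A2_def)
    show ?thesis
      using successive_crossings_opposite[OF c P_eq(2) xy(1,2) reg(1)[OF xy(1)] reg(1)[OF xy(2)]
          reg(2)[OF xy(1)] reg(2)[OF xy(2)] im[OF xy(1)] im[OF xy(2)] xy(3)]
      by (simp add: rho(1) xy(1,2))
  qed

  let ?R = "\<lambda>x y. x \<in> P \<and> y \<in> P \<and> signed_adj c1 c2 x y = 1"
  \<comment> \<open>The sign of \<open>rho\<close> annihilates one of the two terms of
    \<open>signed_adj\<close>. For \<open>- 1\<close> the surviving clockwise step is a reversed
    \<open>A2\<close> step.\<close>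
  have R_pos: "?R x y \<longleftrightarrow> A1 x y" if "x \<in> P" "rho c1 c2 x = 1" for x y
    using that by (simp add: signed_adj_def A1_def P_def)
  have R_neg: "?R x y \<longleftrightarrow> A2 y x" if "x \<in> P" "rho c1 c2 x = - 1" for x y
    using that by (auto simp: signed_adj_def A2_def P_def adj_cw_eq_adj_ccw[OF c(2)])
  have vals: "signed_adj c1 c2 x y \<in> {0, 1}" if "x \<in> P" for x y
    using rho_cases[OF that] by (auto simp: signed_adj_def adj_ccw_def adj_cw_def)
  have total: "\<exists>y. ?R x y" if "x \<in> P" for x
    using rho_cases[OF that] R_pos[OF that] R_neg[OF that] A1[OF that] A2[OF that] by metis
  have R_rho: "rho c1 c2 x = - rho c1 c2 y" if "?R x y" for x y
    using that rho_cases[of x] R_pos[of x y] R_neg[of x y] A1_rho[of x y] A2_rho[of y x] by auto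
  \<comment> \<open>Both predecessors have the sign opposite to that of \<open>y\<close>, so both
    steps run along the same curve, where uniqueness is known.\<close>
  have unique: "x = x'" if "?R x y" "?R x' y" for x x' y
  proof -
    have "rho c1 c2 x = rho c1 c2 x'"
      using R_rho[OF that(1)] R_rho[OF that(2)] by simp
    then show ?thesis
      using that rho_cases[of x] R_pos[of x y] R_pos[of x' y] R_neg[of x y] R_neg[of x' y]
        A1_unique[of x y x'] A2_unique[of y x x'] by auto
  qed
  have sym: "?R\<^sup>*\<^sup>* y x" if "?R\<^sup>*\<^sup>* x y" for x y
  proof (rule rtranclp_sym_if_left_unique[of P ?R, OF fin])
    show "?R u w \<Longrightarrow> u \<in> P \<and> w \<in> P" for u w by blast
    show "\<exists>w. ?R u w" if "u \<in> P" for u using total[OF that] .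
    show "u = u'" if "?R u w" "?R u' w" for u u' w using unique[OF that] .
    show "?R\<^sup>*\<^sup>* x y" by (fact that)
  qed
  have linked_iff: "linked c1 c2 x y \<longleftrightarrow> ?R\<^sup>*\<^sup>* x y" if "x \<in> P" for x y
    unfolding P_def by (rule linked_iff_rtranclp) (use vals that in \<open>simp_all add: P_def\<close>)
  have "linked c1 c2 y x" if "x \<in> P" "y \<in> P" "linked c1 c2 x y" for x y
    using sym[of x y] that by (simp add: linked_iff)
  then show ?thesis
    by (auto simp: P_def assms(5))
qed

end
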